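(* Assume that the sets $Q$ and $A$ are convex, the function $R$ is concave and the function $C$ is convex. Then for any $\eta\in\mathscr M_H$ we have $\mathscr M_\eta\neq\emptyset$. Hence a stationary strategy is optimal for zero initial inventory: there is $\widehat u\in\arg\max_{u\in Q\cap A}\{R(u)-C(u)\}$ such that $\alpha_t=q_t=\widehat u$, $t\ge0$, attains the supremum defining $v(0)$.
   Context: Setting. $\mathbb R_+=[0,\infty)$. $A\subset\mathbb R_+$ is a closed set and $Q\subset\mathbb R_+$ is a compact set, with $0\in A\cap Q$, $A\setminus\{0\}\ne\emptyset$, $Q\setminus\{0\}\neq\emptyset$. The revenue $R:Q\to\mathbb R_+$ is continuous with $R(0)=0$. The production cost $C:A\to\mathbb R_+$ is continuous and non-decreasing; if $A$ is unbounded, then additionally $C(\alpha)/\alpha\to+\infty$ as $A\ni\alpha\to+\infty$. The constant $\beta>0$ is fixed. Admissible strategies and value function. For $x\ge 0$, $\mathscr A(x)$ is the set of pairs of Borel measurable functions $\alpha:\mathbb R_+\to A$, $q:\mathbb R_+\to Q$ (with $\alpha$ locally integrable) such that $X_t=x+\int_0^t(\alpha_s-q_s)\,ds\ge 0$ for all $t\ge 0$. The value function is $$v(x)=\sup_{(\alpha,q)\in\mathscr A(x)}\int_0^\infty e^{-\beta t}(R(q_t)-C(\alpha_t))\,dt,\quad x\ge 0.$$ Notation. $H(z)=\sup_{q\in Q}\{R(q)-qz\}+\sup_{\alpha\in A}\{\alpha z-C(\alpha)\}$ for $z\in\mathbb R$; $\mathscr M_H=\arg\min_{z\in\mathbb R}H(z)$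 (a non-empty set). For $\eta\in\mathbb R$ $$\mathscr M_R(\eta)=\arg\max_{q\in Q}\{R(q)-\eta q\},\quad \mathscr M_C(\eta)=\arg\max_{\alpha\in A}\{\alpha\eta-C(\alpha)\},\quad \mathscr M_\eta=\mathscr M_R(\eta)\cap\mathscr M_C(\eta).$$ *)

theory Defs
  imports "HOL-Analysis.Analysis"
begin

text \<open>Functions on the half-line \<^term>\<open>{0..}\<close> are represented by total functions on the
  reals; their values at negative times are never used.\<close>

definition inventory :: "real \<Rightarrow> (real \<Rightarrow> real) \<Rightarrow> (real \<Rightarrow> real) \<Rightarrow> real \<Rightarrow> real" where
  "inventory x \<alpha> q t = x + (LBINT s:{0..t}. \<alpha> s - q s)"

text \<open>No integrability of the second component is required in \<open>admissible\<close>: it is bounded as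
  soon as \<open>Q\<close> is compact, so that the integral in \<open>inventory\<close> is a genuine one.\<close>

definition admissible ::
    "real set \<Rightarrow> real set \<Rightarrow> real \<Rightarrow> ((real \<Rightarrow> real) \<times> (real \<Rightarrow> real)) set" where
  "admissible A Q x = {(\<alpha>, q).
     \<alpha> \<in> borel_measurable (restrict_space borel {0..}) \<and>
     q \<in> borel_measurable (restrict_space borel {0..}) \<and>
     (\<forall>t\<ge>0. \<alpha> t \<in> A) \<and> (\<forall>t\<ge>0. q t \<in> Q) \<and>
     (\<forall>T\<ge>0. set_integrable lborel {0..T} \<alpha>) \<and>
     (\<forall>t\<ge>0. inventory x \<alpha> q t \<ge> 0)}"

text \<open>The Lebesgue integral over \<^term>\<open>{0..}\<close> of a function with integrable positive part, as an
  extended real (possibly \<open>-\<infinity>\<close>). The Bochner integral would give the value 0 to strategies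
  of infinite cost.\<close>

definition halfline_integral :: "(real \<Rightarrow> real) \<Rightarrow> ereal" where
  "halfline_integral f =
     enn2ereal (\<integral>\<^sup>+t\<in>{0..}. ennreal (f t) \<partial>lborel) -
     enn2ereal (\<integral>\<^sup>+t\<in>{0..}. ennreal (- f t) \<partial>lborel)"

definition payoff ::
    "real \<Rightarrow> (real \<Rightarrow> real) \<Rightarrow> (real \<Rightarrow> real) \<Rightarrow> (real \<Rightarrow> real) \<Rightarrow> (real \<Rightarrow> real) \<Rightarrow> ereal" where
  "payoff \<beta> R C \<alpha> q = halfline_integral (\<lambda>t. exp (- \<beta> * t) * (R (q t) - C (\<alpha> t)))"

definition value_function ::
    "real set \<Rightarrow> real set \<Rightarrow> (real \<Rightarrow> real) \<Rightarrow> (real \<Rightarrow> real) \<Rightarrow> real \<Rightarrow> real \<Rightarrow> ereal" where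
  "value_function A Q R C \<beta> x = (SUP (\<alpha>, q) \<in> admissible A Q x. payoff \<beta> R C \<alpha> q)"

text \<open>The suprema in \<open>H\<close> are real suprema; both are taken over non-empty sets that are bounded
  above when \<open>Q\<close> is compact, \<open>R\<close> and \<open>C\<close> are continuous, \<open>A\<close> is closed, and \<open>C\<close> grows
  superlinearly if \<open>A\<close> is unbounded.\<close>

definition H :: "real set \<Rightarrow> real set \<Rightarrow> (real \<Rightarrow> real) \<Rightarrow> (real \<Rightarrow> real) \<Rightarrow> real \<Rightarrow> real" where
  "H A Q R C z = (SUP q\<in>Q. R q - q * z) + (SUP \<alpha>\<in>A. \<alpha> * z - C \<alpha>)"

definition M_H :: "real set \<Rightarrow> real set \<Rightarrow> (real \<Rightarrow> real) \<Rightarrow> (real \<Rightarrow> real) \<Rightarrow> real set" where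
  "M_H A Q R C = {z. is_arg_min (H A Q R C) (\<lambda>_. True) z}"

definition M_R :: "real set \<Rightarrow> (real \<Rightarrow> real) \<Rightarrow> real \<Rightarrow> real set" where
  "M_R Q R \<eta> = {q. is_arg_max (\<lambda>q. R q - \<eta> * q) (\<lambda>q. q \<in> Q) q}"

definition M_C :: "real set \<Rightarrow> (real \<Rightarrow> real) \<Rightarrow> real \<Rightarrow> real set" where
  "M_C A C \<eta> = {\<alpha>. is_arg_max (\<lambda>\<alpha>. \<alpha> * \<eta> - C \<alpha>) (\<lambda>\<alpha>. \<alpha> \<in> A) \<alpha>}"

definition M :: "real set \<Rightarrow> real set \<Rightarrow> (real \<Rightarrow> real) \<Rightarrow> (real \<Rightarrow> real) \<Rightarrow> real \<Rightarrow> real set" where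
  "M A Q R C \<eta> = M_R Q R \<eta> \<inter> M_C A C \<eta>"

end

theory Submission
  imports Defs
begin

text \<open>Write \<open>V\<close> for the maximum of \<open>R u - C u\<close> over the compact set \<open>Q \<inter> A\<close>, attained at \<open>u\<close>.
  Everything follows from one \<open>\<eta> \<ge> 0\<close> with
  \<open>R q - C a \<le> V + \<eta> * (q - a)\<close> for all \<open>q \<in> Q\<close> and \<open>a \<in> A\<close>.
  Such an \<open>\<eta>\<close> is a Lagrange multiplier for the constraint \<open>q = a\<close>, the marginal value of a unit
  of stock. Convexity provides it (\<open>supporting_price_exists\<close>), because the selling rate may
  be chosen above as well as below the production rate. It is non-negative because the value \<open>V\<close>
  can also be reached, or exceeded, by selling strictly more than is produced: if
  \<open>u > 0\<close>, selling \<open>u\<close> and producing nothing only saves cost; if \<open>u = 0\<close>, selling a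
  positive quantity only adds revenue.

  The inequality says that \<open>H \<eta> \<le> V\<close>, hence \<open>H z \<le> V\<close> for every minimiser \<open>z\<close> of \<open>H\<close>. Pairing any
  \<open>q\<close> and \<open>a\<close> with \<open>u\<close> in the two suprema that make up \<open>H z\<close> then forces \<open>u\<close> to attain both of
  them (\<open>optimum_in_M_if_H_le\<close>). The same \<open>u\<close> therefore lies in \<open>M\<close> at each minimiser.

  Along an admissible strategy that starts from an empty stock the profit rate is at most
  \<open>V + \<eta> (q\<^sub>t - \<alpha>\<^sub>t)\<close>. The second term has discounted integral at most 0 over each \<open>[0, T]\<close>,
  because all that is sold has been produced before and discounting weighs earlier times more
  (\<open>discounted_integral_nonneg\<close>). Letting \<open>T\<close> tend to infinity, no strategy beats the constant
  rate \<open>u\<close>, which earns exactly \<open>V\<close> at each time (\<open>payoff_le_if_supporting\<close>).\<close>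

section \<open>A supporting price\<close>

text \<open>Mixing the surplus pair \<open>(q, a)\<close> with the deficit pair \<open>(q', a')\<close> in the proportion that
  makes the net change of stock vanish gives a point of \<open>Q \<inter> A\<close>. Its profit is at least the same
  mixture of the two profits, and at most \<open>V\<close>.\<close>

lemma slope_le_slope_if_concave_convex:
  fixes R C :: "real \<Rightarrow> real"
  assumes R: "concave_on Q R" and C: "convex_on A C"
    and V: "\<And>w. w \<in> Q \<inter> A \<Longrightarrow> R w - C w \<le> V"
    and qa: "q \<in> Q" "a \<in> A" "a < q" and qa': "q' \<in> Q" "a' \<in> A" "q' < a'"
  shows "(R q - C a - V) / (q - a) \<le> (V - (R q' - C a')) / (a' - q')"
proof -
  define d e where "d = q - a" and "e = a' - q'"
  have pos: "d > 0" "e > 0" using qa qa' by (auto simp: d_def e_def)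
  \<comment> \<open>The weights for which surplus and deficit cancel: \<open>s * d = t * e\<close>.\<close>
  define s t where "s = e / (d + e)" and "t = d / (d + e)"
  have st: "s \<ge> 0" "t \<ge> 0" "s + t = 1" 
    using pos by (auto simp: s_def t_def simp flip: add_divide_distrib)
  define w where "w = s * q + t * q'"
  have "s * (q - a) = t * (a' - q')" by (simp add: s_def t_def flip: d_def e_def)
  then have w: "w = s * a + t * a'" by (simp add: w_def algebra_simps)
  have wQ: "w \<in> Q" and Rw: "s * R q + t * R q' \<le> R w"
    using R st qa qa' by (auto simp: concave_on_iff w_def convex_def)
  have wA: "w \<in> A" and Cw: "C w \<le> s * C a + t * C a'"
    using C st qa qa' by (auto simp: convex_on_def w convex_def)
  have "s * (R q - C a) + t * (R q' - C a') \<le> V"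
    using V[of w] wQ wA Rw Cw by (simp add: algebra_simps)
  also have "V = s * V + t * V" using st by (simp flip: distrib_right)
  finally have "s * (R q - C a - V) \<le> t * (V - (R q' - C a'))" by (simp add: algebra_simps)
  then have "e * (R q - C a - V) \<le> d * (V - (R q' - C a'))"
    using pos by (simp add: s_def t_def divide_right_mono divide_le_cancel)
  then show ?thesis using pos by (simp add: field_simps flip: d_def e_def)
qed

text \<open>The supremum of the slopes over surplus pairs serves as \<open>\<eta>\<close>. A surplus pair makes the set of
  slopes non-empty and a deficit pair bounds it: together they are a Slater condition. Without it
  the supporting line could be vertical.\<close>

lemma supporting_price_exists:
  fixes R C :: "real \<Rightarrow> real"
  assumes R: "concave_on Q R" and C: "convex_on A C"
    and V: "\<And>w. w \<in> Q \<inter> A \<Longrightarrow> R w - C w \<le> V"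
    and surplus: "q\<^sub>0 \<in> Q" "a\<^sub>0 \<in> A" "a\<^sub>0 < q\<^sub>0" and deficit: "q\<^sub>1 \<in> Q" "a\<^sub>1 \<in> A" "q\<^sub>1 < a\<^sub>1"
  obtains \<eta> where "\<And>q a. q \<in> Q \<Longrightarrow> a \<in> A \<Longrightarrow> R q - C a \<le> V + \<eta> * (q - a)"
proof -
  define S where "S = {(R q - C a - V) / (q - a) | q a. q \<in> Q \<and> a \<in> A \<and> a < q}"
  note slopes = slope_le_slope_if_concave_convex[OF R C V]
  have S_ne: "S \<noteq> {}" using surplus by (auto simp: S_def)
  have S_bdd: "bdd_above S"
    by (rule bdd_aboveI[of _ "(V - (R q\<^sub>1 - C a\<^sub>1)) / (a\<^sub>1 - q\<^sub>1)"])
       (auto simp: S_def intro!: slopes deficit)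
  show ?thesis
  proof
    fix q a assume qa: "q \<in> Q" "a \<in> A"
    consider "a < q" | "a = q" | "q < a" by linarith
    then show "R q - C a \<le> V + Sup S * (q - a)"
    proof cases
      case 1
      then have "(R q - C a - V) / (q - a) \<le> Sup S"
        using qa by (intro cSup_upper S_bdd) (auto simp: S_def)
      with 1 show ?thesis by (simp add: field_simps)
    next
      case 2
      then show ?thesis using V[of q] qa by simp
    next
      case 3
      then have "Sup S \<le> (V - (R q - C a)) / (a - q)"
        using qa by (intro cSup_least S_ne) (auto simp: S_def intro!: slopes)
      with 3 show ?thesis by (simp add: field_simps)
    qed
  qed
qed

section \<open>Minimisers of the dual function\<close>

text \<open>Superlinear growth makes the expression non-positive beyond some \<open>N\<close>, and on \<open>A \<inter> {0..N}\<close> it is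
  a continuous function on a compact set. Boundedness matters because real suprema of unbounded
  sets carry no information.\<close>

lemma bdd_above_linear_minus_cost:
  fixes C :: "real \<Rightarrow> real"
  assumes A: "closed A" "A \<subseteq> {0..}" and C: "continuous_on A C"
    and superlinear: "\<not> bounded A \<Longrightarrow> filterlim (\<lambda>\<alpha>. C \<alpha> / \<alpha>) at_top (inf at_top (principal A))"
  shows "bdd_above ((\<lambda>\<alpha>. \<alpha> * z - C \<alpha>) ` A)"
proof -
  obtain N where N: "\<And>\<alpha>. \<alpha> \<in> A \<Longrightarrow> N < \<alpha> \<Longrightarrow> \<alpha> * z - C \<alpha> \<le> 0"
  proof (cases "bounded A")
    case True
    then obtain N where "\<forall>\<alpha>\<in>A. \<bar>\<alpha>\<bar> \<le> N" by (auto simp: bounded_real)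
    then show ?thesis by (intro that[of N]) fastforce
  next
    case False
    then have "\<forall>\<^sub>F \<alpha> in inf at_top (principal A). z \<le> C \<alpha> / \<alpha>"
      using superlinear by (simp add: filterlim_at_top)
    then obtain N where N: "\<And>\<alpha>. \<alpha> \<ge> N \<Longrightarrow> \<alpha> \<in> A \<Longrightarrow> z \<le> C \<alpha> / \<alpha>"
      by (auto simp: eventually_inf_principal eventually_at_top_linorder)
    show ?thesis
    proof (rule that[of "max N 0"])
      fix \<alpha> assume "\<alpha> \<in> A" "max N 0 < \<alpha>"
      then show "\<alpha> * z - C \<alpha> \<le> 0" using N[of \<alpha>] by (simp add: field_simps)
    qed
  qed
  have "compact (A \<inter> {0..N})" using A by (simp add: closed_Int_compact)
  then have "compact ((\<lambda>\<alpha>. \<alpha> * z - C \<alpha>) ` (A \<inter> {0..N}))"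
    by (rule compact_continuous_image[rotated])
       (intro continuous_intros continuous_on_subset[OF C], auto)
  then obtain K where K: "\<And>\<alpha>. \<alpha> \<in> A \<inter> {0..N} \<Longrightarrow> \<alpha> * z - C \<alpha> \<le> K"
    using bounded_imp_bdd_above[OF compact_imp_bounded] by (force simp: bdd_above_def)
  show ?thesis
  proof (rule bdd_aboveI2[of _ _ "max K 0"])
    fix \<alpha> assume "\<alpha> \<in> A"
    then show "\<alpha> * z - C \<alpha> \<le> max K 0" using A K[of \<alpha>] N[of \<alpha>] by (cases "N < \<alpha>") auto
  qed
qed

lemma H_le_if_supporting:
  assumes "Q \<noteq> {}" "A \<noteq> {}"
    and supp: "\<And>q a. q \<in> Q \<Longrightarrow> a \<in> A \<Longrightarrow> R q - C a \<le> V + \<eta> * (q - a)"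
  shows "H A Q R C \<eta> \<le> V"
proof -
  have "(SUP q\<in>Q. R q - q * \<eta>) \<le> V - (a * \<eta> - C a)" if "a \<in> A" for a
    using supp[OF _ that] by (intro cSUP_least assms) (auto simp: algebra_simps)
  then have "(SUP a\<in>A. a * \<eta> - C a) \<le> V - (SUP q\<in>Q. R q - q * \<eta>)"
    by (intro cSUP_least assms) (auto simp: algebra_simps)
  then show ?thesis by (simp add: H_def)
qed

text \<open>Each of the two terms of \<open>H\<close> is at least its value at \<open>u\<close>, and these values add up to
  \<open>R u - C u\<close>; an upper bound of that size leaves no room for anything larger in either term.\<close>

lemma optimum_in_M_if_H_le:
  assumes bdd: "bdd_above ((\<lambda>q. R q - q * \<eta>) ` Q)" "bdd_above ((\<lambda>a. a * \<eta> - C a) ` A)"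
    and u: "u \<in> Q" "u \<in> A" and H: "H A Q R C \<eta> \<le> R u - C u"
  shows "u \<in> M A Q R C \<eta>"
proof -
  have *: "(R q - q * \<eta>) + (a * \<eta> - C a) \<le> R u - C u" if "q \<in> Q" "a \<in> A" for q a
    using cSUP_upper[OF that(1) bdd(1)] cSUP_upper[OF that(2) bdd(2)] H by (simp add: H_def)
  have "R q - \<eta> * q \<le> R u - \<eta> * u" if "q \<in> Q" for q
    using *[OF that u(2)] by (simp add: algebra_simps)
  moreover have "a * \<eta> - C a \<le> u * \<eta> - C u" if "a \<in> A" for a
    using *[OF u(1) that] by (simp add: algebra_simps)
  ultimately show ?thesis using u by (auto simp: M_def M_R_def M_C_def is_arg_max_linorder)
qed

section \<open>Discounted integrals\<close>

text \<open>By the second mean value theorem the discounted integral is a combination, with non-negative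
  weights \<open>1 - exp (- \<beta> * T)\<close> and \<open>exp (- \<beta> * T)\<close>, of two values of the primitive of \<open>g\<close>.\<close>

lemma discounted_integral_nonneg:
  fixes g :: "real \<Rightarrow> real"
  assumes "\<beta> \<ge> 0" "T \<ge> 0" and g: "set_integrable lborel {0..T} g"
    and primitive: "\<And>t. 0 \<le> t \<Longrightarrow> t \<le> T \<Longrightarrow> (LBINT s:{0..t}. g s) \<ge> 0"
  shows "set_integrable lborel {0..T} (\<lambda>t. exp (- \<beta> * t) * g t)"
    and "(LBINT t:{0..T}. exp (- \<beta> * t) * g t) \<ge> 0"
proof -
  have sub: "set_integrable lborel {0..t} g" if "t \<le> T" for t
    using that by (intro set_integrable_subset[OF g]) auto
  have G: "integral {0..t} g \<ge> 0" if "0 \<le> t" "t \<le> T" for t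
    using primitive[OF that] set_borel_integral_eq_integral(2)[OF sub[OF that(2)]] by simp
  have g': "g integrable_on {0..T}" using g by (rule set_borel_integral_eq_integral)
  show int: "set_integrable lborel {0..T} (\<lambda>t. exp (- \<beta> * t) * g t)"
  proof (rule set_integrable_bound[OF g])
    show "set_borel_measurable lborel {0..T} (\<lambda>t. exp (- \<beta> * t) * g t)"
      using borel_measurable_times[of "\<lambda>t. exp (- \<beta> * t)" lborel, OF _ borel_measurable_integrable[OF g[unfolded set_integrable_def]]]
      by (simp add: set_borel_measurable_def mult_ac)
    show "AE t in lborel. t \<in> {0..T} \<longrightarrow> norm (exp (- \<beta> * t) * g t) \<le> norm (g t)"
      using \<open>\<beta> \<ge> 0\<close> by (auto simp: abs_mult intro!: mult_left_le_one_le)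
  qed
  \<comment> \<open>The mean value theorem is stated for increasing weights, hence the sign.\<close>
  obtain c where c: "c \<in> {0..T}" and mean_value:
    "((\<lambda>t. - exp (- \<beta> * t) * g t) has_integral
        - exp (- \<beta> * 0) * integral {0..c} g + - exp (- \<beta> * T) * integral {c..T} g) {0..T}"
    using second_mean_value_theorem_full[OF g' \<open>T \<ge> 0\<close>, of "\<lambda>t. - exp (- \<beta> * t)"] \<open>\<beta> \<ge> 0\<close>
    by (auto intro: mult_left_mono)
  have "integral {0..T} (\<lambda>t. exp (- \<beta> * t) * g t)
      = integral {0..c} g + exp (- \<beta> * T) * integral {c..T} g"
    using integral_unique[OF has_integral_neg[OF mean_value]] by simp
  also have "integral {c..T} g = integral {0..T} g - integral {0..c} g"
    using Henstock_Kurzweil_Integration.integral_combine[OF _ _ g', of c] c by simp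
  also have "integral {0..c} g + exp (- \<beta> * T) * (integral {0..T} g - integral {0..c} g)
      = (1 - exp (- \<beta> * T)) * integral {0..c} g + exp (- \<beta> * T) * integral {0..T} g"
    by (simp add: algebra_simps)
  also have "\<dots> \<ge> 0"
    using c assms G by (intro add_nonneg_nonneg mult_nonneg_nonneg) auto
  finally show "(LBINT t:{0..T}. exp (- \<beta> * t) * g t) \<ge> 0"
    using set_borel_integral_eq_integral(2)[OF int] by simp
qed

lemma set_integrable_discount:
  assumes "\<beta> > 0"
  shows "set_integrable lborel {0..} (\<lambda>t. exp (- \<beta> * t) :: real)"
proof -
  have "(\<lambda>t. exp (- \<beta> * t)) absolutely_integrable_on {0..}"
    using has_integral_exp_minus_to_infinity[OF assms, of 0]
    by (intro nonnegative_absolutely_integrable_1) (auto simp: integrable_on_def)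
  then show ?thesis
    by (simp add: set_integrable_def integrable_completion)
qed

lemma halfline_integral_eq_LBINT:
  assumes "set_integrable lborel {0..} f"
  shows "halfline_integral f = ereal (LBINT t:{0..}. f t)"
proof -
  let ?f = "\<lambda>t. indicator {0..} t *\<^sub>R f t"
  have int: "integrable lborel ?f" using assms by (simp add: set_integrable_def)
  have eq: "(\<integral>\<^sup>+t\<in>{0..}. ennreal (f t) \<partial>lborel) = (\<integral>\<^sup>+t. ennreal (?f t) \<partial>lborel)"
    "(\<integral>\<^sup>+t\<in>{0..}. ennreal (- f t) \<partial>lborel) = (\<integral>\<^sup>+t. ennreal (- ?f t) \<partial>lborel)"
    by (auto intro!: nn_integral_cong simp: indicator_def)
  obtain p n where pn: "(\<integral>\<^sup>+t. ennreal (?f t) \<partial>lborel) = ennreal p" "p \<ge> 0"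
    "(\<integral>\<^sup>+t. ennreal (- ?f t) \<partial>lborel) = ennreal n" "n \<ge> 0"
  proof -
    have "(\<integral>\<^sup>+t. ennreal (?f t) \<partial>lborel) < top" "(\<integral>\<^sup>+t. ennreal (- ?f t) \<partial>lborel) < top"
      using int unfolding real_integrable_def by (simp_all add: less_top)
    then show ?thesis
      by (intro that[OF ennreal_enn2real[symmetric] _ ennreal_enn2real[symmetric]]) auto
  qed
  then have "(LBINT t:{0..}. f t) = p - n"
    using real_lebesgue_integral_def[OF int] by (simp add: set_lebesgue_integral_def)
  then show ?thesis
    unfolding halfline_integral_def eq pn(1,3) using pn(2,4) by (simp add: enn2ereal_ennreal)
qed

text \<open>The dominating \<open>b\<close> keeps the positive part finite, so only the negative part can prevent
  integrability.\<close>

lemma halfline_integral_eq_MInfty: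
  assumes f: "set_borel_measurable lborel {0..} f" and "\<not> set_integrable lborel {0..} f"
    and b: "set_integrable lborel {0..} b" and le: "\<And>t. t \<ge> 0 \<Longrightarrow> f t \<le> b t"
  shows "halfline_integral f = - \<infinity>"
proof -
  let ?f = "\<lambda>t. indicator {0..} t *\<^sub>R f t"
  have eq: "(\<integral>\<^sup>+t\<in>{0..}. ennreal (f t) \<partial>lborel) = (\<integral>\<^sup>+t. ennreal (?f t) \<partial>lborel)"
    "(\<integral>\<^sup>+t\<in>{0..}. ennreal (- f t) \<partial>lborel) = (\<integral>\<^sup>+t. ennreal (- ?f t) \<partial>lborel)"
    by (auto intro!: nn_integral_cong simp: indicator_def)
  have "(\<integral>\<^sup>+t. ennreal (?f t) \<partial>lborel) \<le> (\<integral>\<^sup>+t. ennreal (indicator {0..} t *\<^sub>R b t) \<partial>lborel)"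
    using le by (intro nn_integral_mono ennreal_leI) (auto simp: indicator_def)
  also have "\<dots> < \<infinity>" using b by (simp add: set_integrable_def real_integrable_def less_top)
  finally have fin: "(\<integral>\<^sup>+t. ennreal (?f t) \<partial>lborel) < \<infinity>" .
  with assms(1,2) have inf: "(\<integral>\<^sup>+t. ennreal (- ?f t) \<partial>lborel) = \<infinity>"
    by (auto simp: set_integrable_def set_borel_measurable_def real_integrable_def)
  from fin obtain p where "(\<integral>\<^sup>+t. ennreal (?f t) \<partial>lborel) = ennreal p" "p \<ge> 0"
    using enn2real_nonneg ennreal_enn2real by (metis infinity_ennreal_def)
  with inf show ?thesis by (simp add: halfline_integral_def eq enn2ereal_ennreal)
qed

text \<open>The comparison function \<open>g\<close> is controlled on bounded intervals only: it need not be
  integrable on the half-line. The inequality is therefore obtained on \<open>{0..T}\<close> and passed to the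
  limit, which is legitimate once \<open>f\<close> is integrable; if it is not, its integral is \<open>-\<infinity>\<close>.\<close>

lemma halfline_integral_le_if_dominated:
  fixes f b g :: "real \<Rightarrow> real"
  assumes f: "set_borel_measurable lborel {0..} f"
    and b: "set_integrable lborel {0..} b" "\<And>t. t \<ge> 0 \<Longrightarrow> f t \<le> b t"
    and h: "set_integrable lborel {0..} h"
    and g: "\<And>T. T \<ge> 0 \<Longrightarrow> set_integrable lborel {0..T} g"
           "\<And>T. T \<ge> 0 \<Longrightarrow> (LBINT t:{0..T}. g t) \<ge> 0"
    and le: "\<And>t. t \<ge> 0 \<Longrightarrow> f t \<le> h t - g t"
  shows "halfline_integral f \<le> ereal (LBINT t:{0..}. h t)"
proof (cases "set_integrable lborel {0..} f")
  case False
  then show ?thesis by (simp add: halfline_integral_eq_MInfty[OF f False b])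
next
  case True
  have sub: "set_integrable lborel {0..T} F" if "set_integrable lborel {0..} F"
    for F :: "real \<Rightarrow> real" and T
    using that by (rule set_integrable_subset) auto
  have lim: "((\<lambda>T. LBINT t:{0..T}. F t) \<longlongrightarrow> (LBINT t:{0..}. F t)) at_top"
    if "set_integrable lborel {0..} F" for F :: "real \<Rightarrow> real"
    using that by (intro tendsto_set_lebesgue_integral_at_top) auto
  have "(LBINT t:{0..T}. f t) \<le> (LBINT t:{0..T}. h t)" if "T \<ge> 0" for T
  proof -
    have "(LBINT t:{0..T}. f t) \<le> (LBINT t:{0..T}. h t - g t)"
      using le by (intro set_integral_mono set_integral_diff sub True h g that) auto
    also have "\<dots> = (LBINT t:{0..T}. h t) - (LBINT t:{0..T}. g t)"
      by (intro set_integral_diff sub h g that)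
    finally show ?thesis using g(2)[OF that] by simp
  qed
  then have "(LBINT t:{0..}. f t) \<le> (LBINT t:{0..}. h t)"
    by (intro tendsto_le[OF _ lim[OF h] lim[OF True]])
       (auto intro: eventually_mono[OF eventually_ge_at_top[of 0]])
  then show ?thesis by (simp add: halfline_integral_eq_LBINT[OF True])
qed

lemma set_borel_measurable_compose_continuous:
  fixes \<alpha> F :: "real \<Rightarrow> real"
  assumes \<alpha>: "\<alpha> \<in> borel_measurable (restrict_space borel {0..})" "\<And>t. t \<ge> 0 \<Longrightarrow> \<alpha> t \<in> A"
    and F: "continuous_on A F"
  shows "set_borel_measurable lborel {0..} (\<lambda>t. F (\<alpha> t))"
proof -
  have "\<alpha> \<in> restrict_space borel {0..} \<rightarrow>\<^sub>M restrict_space borel A"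
    using \<alpha> by (intro measurable_restrict_space2) (auto simp: space_restrict_space)
  from measurable_compose[OF this borel_measurable_continuous_on_restrict[OF F]]
  show ?thesis
    by (simp add: set_borel_measurable_def borel_measurable_restrict_space_iff)
qed

text \<open>The net production \<open>\<alpha> t - q t\<close> has the inventory as primitive when the initial stock is 0.\<close>

lemma admissible_zero_discounted_production:
  assumes Q: "bounded Q" and "\<beta> \<ge> 0" "T \<ge> 0" and adm: "(\<alpha>, q) \<in> admissible A Q 0"
  shows "set_integrable lborel {0..T} (\<lambda>t. exp (- \<beta> * t) * (\<alpha> t - q t))"
    and "(LBINT t:{0..T}. exp (- \<beta> * t) * (\<alpha> t - q t)) \<ge> 0"
proof -
  have \<alpha>: "\<And>T. T \<ge> 0 \<Longrightarrow> set_integrable lborel {0..T} \<alpha>"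
    and q_meas: "q \<in> borel_measurable (restrict_space borel {0..})"
    and q_Q: "\<And>t. t \<ge> 0 \<Longrightarrow> q t \<in> Q"
    and X: "\<And>t. t \<ge> 0 \<Longrightarrow> (LBINT s:{0..t}. \<alpha> s - q s) \<ge> 0"
    using adm by (auto simp: admissible_def inventory_def)
  obtain K where K: "\<And>x. x \<in> Q \<Longrightarrow> \<bar>x\<bar> \<le> K" using Q by (auto simp: bounded_real)
  have q: "set_integrable lborel {0..T} q"
  proof (rule set_integrable_bound)
    show "set_integrable lborel {0..T} (\<lambda>_. K)"
      by (rule borel_integrable_atLeastAtMost') simp
    have "set_borel_measurable lborel {0..} q"
      using set_borel_measurable_compose_continuous[OF q_meas q_Q, of "\<lambda>x. x"] by simp
    then show "set_borel_measurable lborel {0..T} q"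
      by (rule set_borel_measurable_subset) auto
    show "AE t in lborel. t \<in> {0..T} \<longrightarrow> norm (q t) \<le> norm K"
      using K[OF q_Q] by (fastforce intro: order_trans)
  qed
  have g: "set_integrable lborel {0..T} (\<lambda>t. \<alpha> t - q t)"
    by (intro set_integral_diff \<alpha> q \<open>T \<ge> 0\<close>)
  show "set_integrable lborel {0..T} (\<lambda>t. exp (- \<beta> * t) * (\<alpha> t - q t))"
    "(LBINT t:{0..T}. exp (- \<beta> * t) * (\<alpha> t - q t)) \<ge> 0"
    using discounted_integral_nonneg[OF \<open>\<beta> \<ge> 0\<close> \<open>T \<ge> 0\<close> g] X by auto
qed

section \<open>Optimality of the stationary strategy\<close>

lemma stationary_admissible_zero:
  assumes "u \<in> Q" "u \<in> A"
  shows "(\<lambda>_. u, \<lambda>_. u) \<in> admissible A Q 0"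
  using assms by (simp add: admissible_def inventory_def set_integrable_def set_lebesgue_integral_def)

lemma payoff_stationary:
  assumes "\<beta> > 0"
  shows "payoff \<beta> R C (\<lambda>_. u) (\<lambda>_. u) = ereal ((LBINT t:{0..}. exp (- \<beta> * t)) * (R u - C u))"
  unfolding payoff_def
  using set_integrable_mult_left[OF set_integrable_discount[OF assms]]
  by (subst halfline_integral_eq_LBINT) simp_all

text \<open>The two bounds on the profit rate serve different purposes: the constant \<open>K\<close>, an upper bound
  of \<open>R\<close>, ensures that the integral of the positive part is finite, while the supporting price
  gives the sharp estimate.\<close>

lemma payoff_le_if_supporting:
  assumes Q: "compact Q" and R: "continuous_on Q R" and C: "continuous_on A C"
    and C_nonneg: "C ` A \<subseteq> {0..}" and "\<beta> > 0" "\<eta> \<ge> 0"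
    and supp: "\<And>q a. q \<in> Q \<Longrightarrow> a \<in> A \<Longrightarrow> R q - C a \<le> V + \<eta> * (q - a)"
    and adm: "(\<alpha>, q) \<in> admissible A Q 0"
  shows "payoff \<beta> R C \<alpha> q \<le> ereal ((LBINT t:{0..}. exp (- \<beta> * t)) * V)"
proof -
  have meas: "\<alpha> \<in> borel_measurable (restrict_space borel {0..})"
      "q \<in> borel_measurable (restrict_space borel {0..})"
    and \<alpha>_A: "\<And>t. t \<ge> 0 \<Longrightarrow> \<alpha> t \<in> A" and q_Q: "\<And>t. t \<ge> 0 \<Longrightarrow> q t \<in> Q"
    using adm by (auto simp: admissible_def)
  obtain K where K: "\<And>x. x \<in> Q \<Longrightarrow> R x \<le> K"
    using compact_imp_bounded[OF compact_continuous_image[OF R Q]] 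
    by (auto simp: bounded_real intro: order_trans[OF abs_ge_self])
  note disc = set_integrable_discount[OF \<open>\<beta> > 0\<close>]
  note prod = admissible_zero_discounted_production[OF compact_imp_bounded[OF Q] less_imp_le[OF \<open>\<beta> > 0\<close>] _ adm]
  have "payoff \<beta> R C \<alpha> q \<le> ereal (LBINT t:{0..}. exp (- \<beta> * t) * V)"
    unfolding payoff_def
  proof (rule halfline_integral_le_if_dominated[where b = "\<lambda>t. exp (- \<beta> * t) * K"
        and g = "\<lambda>t. \<eta> * (exp (- \<beta> * t) * (\<alpha> t - q t))"])
    have "(\<lambda>t. exp (- \<beta> * t) * (indicator {0..} t *\<^sub>R R (q t) - indicator {0..} t *\<^sub>R C (\<alpha> t)))
        \<in> borel_measurable lborel"
      using set_borel_measurable_compose_continuous[OF meas(1) \<alpha>_A C]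
        set_borel_measurable_compose_continuous[OF meas(2) q_Q R]
      unfolding set_borel_measurable_def by measurable
    then show "set_borel_measurable lborel {0..} (\<lambda>t. exp (- \<beta> * t) * (R (q t) - C (\<alpha> t)))"
      by (simp add: set_borel_measurable_def algebra_simps)
    fix t :: real assume "t \<ge> 0"
    then have *: "\<alpha> t \<in> A" "q t \<in> Q" by (auto simp: \<alpha>_A q_Q)
    then have "R (q t) - C (\<alpha> t) \<le> K" using K[of "q t"] C_nonneg by force
    then show "exp (- \<beta> * t) * (R (q t) - C (\<alpha> t)) \<le> exp (- \<beta> * t) * K"
      by (intro mult_left_mono) auto
    have "exp (- \<beta> * t) * (R (q t) - C (\<alpha> t)) \<le> exp (- \<beta> * t) * (V + \<eta> * (q t - \<alpha> t))"
      using supp * by (intro mult_left_mono) auto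
    then show "exp (- \<beta> * t) * (R (q t) - C (\<alpha> t))
        \<le> exp (- \<beta> * t) * V - \<eta> * (exp (- \<beta> * t) * (\<alpha> t - q t))"
      by (simp add: algebra_simps)
  next
    fix T :: real assume "T \<ge> 0"
    then show "0 \<le> (LBINT t:{0..T}. \<eta> * (exp (- \<beta> * t) * (\<alpha> t - q t)))"
      using prod(2) \<open>\<eta> \<ge> 0\<close> by (subst set_integral_mult_right) auto
  qed (intro set_integrable_mult_left set_integrable_mult_right disc prod; simp)+
  then show ?thesis by simp
qed

theorem theorem4:
  fixes A Q :: "real set" and R C :: "real \<Rightarrow> real" and \<beta> :: real
  assumes A_closed: "closed A" and A_nonneg: "A \<subseteq> {0..}"
    and Q_compact: "compact Q" and Q_nonneg: "Q \<subseteq> {0..}"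
    and zero_mem: "0 \<in> A \<inter> Q"
    and A_nontrivial: "A - {0} \<noteq> {}" and Q_nontrivial: "Q - {0} \<noteq> {}"
    and R_range: "R ` Q \<subseteq> {0..}" and R_cont: "continuous_on Q R" and R_zero: "R 0 = 0"
    and C_range: "C ` A \<subseteq> {0..}" and C_cont: "continuous_on A C" and C_mono: "mono_on A C"
    and C_superlinear:
      "\<not> bounded A \<Longrightarrow> filterlim (\<lambda>\<alpha>. C \<alpha> / \<alpha>) at_top (inf at_top (principal A))"
    and beta_pos: "\<beta> > 0"
    and Q_convex: "convex Q" and A_convex: "convex A"
    and R_concave: "concave_on Q R" and C_convex: "convex_on A C"
  shows "(\<forall>\<eta>\<in>M_H A Q R C. M A Q R C \<eta> \<noteq> {}) \<and>
    (\<exists>u. is_arg_max (\<lambda>u. R u - C u) (\<lambda>u. u \<in> Q \<inter> A) u \<and>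
      (\<lambda>_. u, \<lambda>_. u) \<in> admissible A Q 0 \<and>
      payoff \<beta> R C (\<lambda>_. u) (\<lambda>_. u) = value_function A Q R C \<beta> 0)"
proof -
  obtain q\<^sub>0 where q0: "q\<^sub>0 \<in> Q" "q\<^sub>0 > 0" using Q_nontrivial Q_nonneg by force
  obtain a\<^sub>1 where a1: "a\<^sub>1 \<in> A" "a\<^sub>1 > 0" using A_nontrivial A_nonneg by force
  have zero: "0 \<in> A" "0 \<in> Q" using zero_mem by auto
  have "compact (Q \<inter> A)" using Q_compact A_closed by (rule compact_Int_closed)
  then obtain u where u: "u \<in> Q" "u \<in> A"
    and u_max: "\<And>w. w \<in> Q \<inter> A \<Longrightarrow> R w - C w \<le> R u - C u"
    using continuous_attains_sup[of "Q \<inter> A" "\<lambda>u. R u - C u"] zero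
      continuous_on_subset[OF R_cont, of "Q \<inter> A"] continuous_on_subset[OF C_cont, of "Q \<inter> A"]
    by (auto intro!: continuous_intros)
  obtain \<eta> where supp: "\<And>q a. q \<in> Q \<Longrightarrow> a \<in> A \<Longrightarrow> R q - C a \<le> R u - C u + \<eta> * (q - a)"
    using supporting_price_exists[OF R_concave C_convex u_max q0(1) zero(1) q0(2) zero(2) a1]
    by blast
  \<comment> \<open>The price is tested on a pair with positive surplus and profit at least \<open>R u - C u\<close>.\<close>
  have "\<eta> \<ge> 0"
  proof (cases "u = 0")
    case True
    then have "0 \<le> \<eta> * q\<^sub>0" using supp[OF q0(1) zero(1)] R_range R_zero q0(1) by force
    then show ?thesis using q0(2) by (simp add: zero_le_mult_iff)
  next
    case False
    then have "u > 0" using u Q_nonneg by force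
    moreover have "C 0 \<le> C u" using C_mono zero u \<open>u > 0\<close> by (auto simp: mono_on_def)
    ultimately have "0 \<le> \<eta> * u" using supp[OF u(1) zero(1)] by simp
    then show ?thesis using \<open>u > 0\<close> by (simp add: zero_le_mult_iff)
  qed
  have "M A Q R C z \<noteq> {}" if "z \<in> M_H A Q R C" for z
  proof -
    have "H A Q R C z \<le> H A Q R C \<eta>"
      using that by (simp add: M_H_def is_arg_min_linorder)
    also have "\<dots> \<le> R u - C u" using zero supp by (intro H_le_if_supporting) auto
    finally have H_z: "H A Q R C z \<le> R u - C u" .
    have bdd_Q: "bdd_above ((\<lambda>q. R q - q * z) ` Q)"
      by (intro bounded_imp_bdd_above compact_imp_bounded compact_continuous_image
          continuous_intros R_cont Q_compact)
    have bdd_A: "bdd_above ((\<lambda>a. a * z - C a) ` A)"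
      using A_closed A_nonneg C_cont C_superlinear by (rule bdd_above_linear_minus_cost)
    show ?thesis using optimum_in_M_if_H_le[where R = R and C = C, OF bdd_Q bdd_A u H_z] by blast
  qed
  moreover have "payoff \<beta> R C (\<lambda>_. u) (\<lambda>_. u) = value_function A Q R C \<beta> 0"
    unfolding value_function_def
  proof (rule antisym)
    show "payoff \<beta> R C (\<lambda>_. u) (\<lambda>_. u) \<le> (SUP (\<alpha>, q) \<in> admissible A Q 0. payoff \<beta> R C \<alpha> q)"
      using SUP_upper[OF stationary_admissible_zero[OF u], of "\<lambda>(\<alpha>, q). payoff \<beta> R C \<alpha> q"] by simp
    show "(SUP (\<alpha>, q) \<in> admissible A Q 0. payoff \<beta> R C \<alpha> q) \<le> payoff \<beta> R C (\<lambda>_. u) (\<lambda>_. u)"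
      using payoff_le_if_supporting[OF Q_compact R_cont C_cont C_range beta_pos \<open>\<eta> \<ge> 0\<close> supp]
      by (auto intro!: SUP_least simp: payoff_stationary[OF beta_pos])
  qed
  ultimately show ?thesis
    using u u_max stationary_admissible_zero[OF u] by (auto simp: is_arg_max_linorder)
qed

end
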